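(* Let $(R_i)_{i\in S}$ be a family of nonzero commutative rings indexed by a set $S$, and let $R=\prod_{i\in S}R_i$. Then there is a continuous imbedding (i.e. a continuous injective map) $f:\operatorname{Spec}(\mathcal P(S))\to\operatorname{Spec}(R)$ which preserves wild primes, that is, a prime ideal $M$ of $\mathcal P(S)$ is a wild prime of $\mathcal P(S)$ if and only if $f(M)$ is a wild prime of $R$.
   Context: All rings are commutative with identity. $\mathcal P(S)$ is the power set ring of $S$ (addition is symmetric difference, multiplication is intersection), which is identified with the product ring $\prod_{k\in S}\mathbb Z_2$, $\mathbb Z_2=\mathbb Z/2\mathbb Z$, by sending a subset to its characteristic function. For a direct product $A=\prod_{i\in S}A_i$ of nonzero rings with projections $\pi_k:A\to A_k$, a tame prime of $A$ is a prime ideal of the form $\pi_k^{-1}(\mathfrak p)$ for some $k\in S$ and some prime ideal $\mathfrak p$ of $A_k$; a wild prime of $A$ is a prime ideal of $A$ which is not tame. Wild primes of $\mathcal P(S)$ are understood via the identification $\mathcal P(S)\simeq\prod_{k\in S}\mathbb Z_2$. Spectra carry the Zariski topology. *)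

theory Defs
  imports "HOL-Analysis.Abstract_Topology" "HOL-Algebra.QuotRing" "HOL-Number_Theory.Residues"
begin

section \<open>Prime spectrum with the Zariski topology\<close>

definition Spec :: "('a, 'm) ring_scheme \<Rightarrow> 'a set set"
  where "Spec A = {P. primeideal P A}"

text \<open>The open sets are the complements of the sets \<open>V(E) = {P. E \<subseteq> P}\<close>.\<close>

definition zariski :: "('a, 'm) ring_scheme \<Rightarrow> 'a set topology"
  where "zariski A =
    topology (\<lambda>U. \<exists>E. E \<subseteq> carrier A \<and> U = Spec A - {P \<in> Spec A. E \<subseteq> P})"

lemma istopology_zariski:
  "istopology (\<lambda>U. \<exists>E. E \<subseteq> carrier A \<and> U = Spec A - {P \<in> Spec A. E \<subseteq> P})"
    (is "istopology ?L")
  unfolding istopology_def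
proof (intro conjI allI impI)
  fix U V assume "?L U" "?L V"
  then obtain E F where E: "E \<subseteq> carrier A" "U = Spec A - {P \<in> Spec A. E \<subseteq> P}"
    and F: "F \<subseteq> carrier A" "V = Spec A - {P \<in> Spec A. F \<subseteq> P}" by auto
  show "?L (U \<inter> V)"
  proof (cases "Spec A = {}")
    case True
    then show ?thesis using E F by auto
  next
    case False
    then obtain Q where "primeideal Q A" by (auto simp: Spec_def)
    then interpret A: cring A by (rule primeideal.axioms(2))
    define G where "G = {a \<otimes>\<^bsub>A\<^esub> b | a b. a \<in> E \<and> b \<in> F}"
    have G: "G \<subseteq> carrier A" using E F by (auto simp: G_def)
    have "E \<subseteq> P \<or> F \<subseteq> P \<longleftrightarrow> G \<subseteq> P" if "P \<in> Spec A" for P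
    proof -
      interpret P: primeideal P A using that by (simp add: Spec_def)
      show ?thesis
      proof
        assume "E \<subseteq> P \<or> F \<subseteq> P"
        then show "G \<subseteq> P" using E F P.I_l_closed P.I_r_closed unfolding G_def by blast
      next
        assume "G \<subseteq> P"
        then have "\<And>a b. a \<in> E \<Longrightarrow> b \<in> F \<Longrightarrow> a \<in> P \<or> b \<in> P"
          using E F P.I_prime unfolding G_def by blast
        then show "E \<subseteq> P \<or> F \<subseteq> P" by blast
      qed
    qed
    then have "U \<inter> V = Spec A - {P \<in> Spec A. G \<subseteq> P}" using E F by blast
    then show ?thesis using G by blast
  qed
next
  fix \<K> assume *: "\<forall>K\<in>\<K>. ?L K"
  then obtain E where E: "\<And>K. K \<in> \<K> \<Longrightarrow> E K \<subseteq> carrier A"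
    "\<And>K. K \<in> \<K> \<Longrightarrow> K = Spec A - {P \<in> Spec A. E K \<subseteq> P}" by metis
  have "\<Union>\<K> = Spec A - {P \<in> Spec A. (\<Union>K\<in>\<K>. E K) \<subseteq> P}"
  proof (rule Set.set_eqI)
    fix P
    have "P \<in> K \<longleftrightarrow> P \<in> Spec A \<and> \<not> E K \<subseteq> P" if "K \<in> \<K>" for K
      using E(2)[OF that] by blast
    then show "P \<in> \<Union>\<K> \<longleftrightarrow> P \<in> Spec A - {P \<in> Spec A. (\<Union>K\<in>\<K>. E K) \<subseteq> P}" by auto
  qed
  moreover have "(\<Union>K\<in>\<K>. E K) \<subseteq> carrier A" using E(1) by blast
  ultimately show "?L (\<Union>\<K>)" by blast
qed

lemma openin_zariski:
  "openin (zariski A) U \<longleftrightarrow> (\<exists>E. E \<subseteq> carrier A \<and> U = Spec A - {P \<in> Spec A. E \<subseteq> P})"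
  unfolding zariski_def topology_inverse'[OF istopology_zariski] ..

lemma topspace_zariski [simp]: "topspace (zariski A) = Spec A"
proof
  show "topspace (zariski A) \<subseteq> Spec A"
    using openin_topspace[of "zariski A"] unfolding openin_zariski by blast
  have "\<not> carrier A \<subseteq> P" if "P \<in> Spec A" for P
  proof -
    interpret P: primeideal P A using that by (simp add: Spec_def)
    show ?thesis using P.I_notcarr P.a_subset by blast
  qed
  then have "Spec A = Spec A - {P \<in> Spec A. carrier A \<subseteq> P}" by blast
  then have "openin (zariski A) (Spec A)" unfolding openin_zariski by blast
  then show "Spec A \<subseteq> topspace (zariski A)" by (rule openin_subset)
qed


section \<open>Direct products, tame and wild primes\<close>

definition product_ring :: "'i set \<Rightarrow> ('i \<Rightarrow> ('a, 'm) ring_scheme) \<Rightarrow> ('i \<Rightarrow> 'a) ring"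
  where "product_ring S R =
    \<lparr>carrier = (\<Pi>\<^sub>E i\<in>S. carrier (R i)),
     monoid.mult = (\<lambda>x y. \<lambda>i\<in>S. x i \<otimes>\<^bsub>R i\<^esub> y i),
     one = (\<lambda>i\<in>S. \<one>\<^bsub>R i\<^esub>),
     zero = (\<lambda>i\<in>S. \<zero>\<^bsub>R i\<^esub>),
     add = (\<lambda>x y. \<lambda>i\<in>S. x i \<oplus>\<^bsub>R i\<^esub> y i)\<rparr>"

lemma product_ring_cring:
  assumes "\<And>i. i \<in> S \<Longrightarrow> cring (R i)"
  shows "cring (product_ring S R)"
proof (rule cringI)
  have R: "\<And>i. i \<in> S \<Longrightarrow> ring (R i)" using assms cring.axioms(1) by blast
  show "abelian_group (product_ring S R)"
  proof (rule abelian_groupI)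
    fix x assume x: "x \<in> carrier (product_ring S R)"
    show "\<exists>y\<in>carrier (product_ring S R). y \<oplus>\<^bsub>product_ring S R\<^esub> x = \<zero>\<^bsub>product_ring S R\<^esub>"
      by (rule bexI[where x = "\<lambda>i\<in>S. \<ominus>\<^bsub>R i\<^esub> x i"])
         (use x R in \<open>auto simp: product_ring_def PiE_iff ring.ring_simprules intro!: restrict_ext\<close>)
  qed (use R in \<open>auto simp: product_ring_def PiE_iff ring.ring_simprules extensional_def fun_eq_iff\<close>)
  show "comm_monoid (product_ring S R)"
    by (rule comm_monoidI)
       (use R assms in \<open>auto simp: product_ring_def PiE_iff ring.ring_simprules cring.cring_simprules
          monoid.r_one[OF ring.is_monoid]
          extensional_def fun_eq_iff\<close>)
qed (use assms in \<open>auto simp: product_ring_def PiE_iff cring.cring_simprules fun_eq_iff\<close>)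

definition tame_prime :: "'i set \<Rightarrow> ('i \<Rightarrow> ('a, 'm) ring_scheme) \<Rightarrow> ('i \<Rightarrow> 'a) set \<Rightarrow> bool"
  where "tame_prime S R P \<longleftrightarrow> primeideal P (product_ring S R) \<and>
    (\<exists>k\<in>S. \<exists>\<pp>. primeideal \<pp> (R k) \<and> P = (\<lambda>x. x k) -` \<pp> \<inter> carrier (product_ring S R))"

definition wild_prime :: "'i set \<Rightarrow> ('i \<Rightarrow> ('a, 'm) ring_scheme) \<Rightarrow> ('i \<Rightarrow> 'a) set \<Rightarrow> bool"
  where "wild_prime S R P \<longleftrightarrow> primeideal P (product_ring S R) \<and> \<not> tame_prime S R P"


section \<open>The power set ring\<close>

definition powerset_ring :: "'i set \<Rightarrow> 'i set ring"
  where "powerset_ring S =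
    \<lparr>carrier = Pow S, monoid.mult = (\<inter>), one = S, zero = {},
     add = sym_diff\<rparr>"

definition char_fun :: "'i set \<Rightarrow> 'i set \<Rightarrow> 'i \<Rightarrow> int"
  where "char_fun S X = (\<lambda>i\<in>S. if i \<in> X then 1 else 0)"

lemma char_fun_ring_iso:
  "char_fun S \<in> ring_iso (powerset_ring S) (product_ring S (\<lambda>_. residue_ring 2))"
proof -
  have "char_fun S \<in> ring_hom (powerset_ring S) (product_ring S (\<lambda>_. residue_ring 2))"
    by (rule ring_hom_memI)
       (auto simp: powerset_ring_def product_ring_def char_fun_def residue_ring_def fun_eq_iff)
  moreover have "bij_betw (char_fun S) (Pow S) (\<Pi>\<^sub>E i\<in>S. {0..1})"
  proof (rule bij_betwI[where g = "\<lambda>x. {i \<in> S. x i = 1}"])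
    fix x :: "'a \<Rightarrow> int" assume x: "x \<in> (\<Pi>\<^sub>E i\<in>S. {0..1})"
    have "char_fun S {i \<in> S. x i = 1} i = x i" for i
    proof (cases "i \<in> S")
      case True
      then have "x i \<in> {0..1}" using x by auto
      then show ?thesis using True by (auto simp: char_fun_def)
    next
      case False
      then show ?thesis using x by (auto simp: char_fun_def PiE_iff extensional_def)
    qed
    then show "char_fun S {i \<in> S. x i = 1} = x" by blast
  qed (auto simp: char_fun_def)
  ultimately show ?thesis
    by (simp add: ring_iso_def powerset_ring_def product_ring_def residue_ring_def)
qed

text \<open>A prime of \<open>powerset_ring S\<close> is wild if it corresponds, under the identification
  \<^const>\<open>char_fun\<close>, to a wild prime of the product of copies of the two-element ring.\<close>

definition wild_prime_powerset :: "'i set \<Rightarrow> 'i set set \<Rightarrow> bool"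
  where "wild_prime_powerset S M \<longleftrightarrow> primeideal M (powerset_ring S) \<and>
    wild_prime S (\<lambda>_. residue_ring 2) (char_fun S ` M)"

end

theory Submission
  imports Defs "HOL-Algebra.Ring_Divisibility"
begin

text \<open>Choose a maximal ideal \<open>\<mm> i\<close> in each factor. An element \<open>x\<close> of the product ring has the support
  \<open>{i. x i \<notin> \<mm> i}\<close>, and taking supports turns products into intersections and sums into subsets of
  unions. Hence the elements whose support lies in a given prime \<open>M\<close> of the power set ring form a
  prime ideal; it determines \<open>M\<close> because every subset of \<open>S\<close> is the support of an idempotent, and it
  is tame exactly when \<open>M\<close> consists of the sets avoiding some point. For the factors \<open>\<int>/2\<close> this
  prime ideal is just \<open>M\<close> itself, so that wildness on both sides has the same characterisation.\<close>

section \<open>Existence of maximal ideals in a nonzero ring\<close>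

lemma (in ring) exists_maximalideal:
  assumes "carrier R \<noteq> {\<zero>}"
  obtains I where "maximalideal I R"
proof -
  \<comment> \<open>Omitting \<open>\<one>\<close> is equivalent to being proper, and in this form
    the condition visibly passes to unions of chains.\<close>
  let ?A = "{I. ideal I R \<and> \<one> \<notin> I}"
  have "\<one> \<noteq> \<zero>"
    using assms one_zeroD by blast
  then have "?A \<noteq> {}"
    using zeroideal by blast
  then have "\<exists>M\<in>?A. \<forall>X\<in>?A. M \<subseteq> X \<longrightarrow> X = M"
  proof (rule subset_Zorn_nonempty)
    fix C assume "C \<noteq> {}" and C: "subset.chain ?A C"
    moreover have "subset.chain {I. ideal I R} C"
      using C by (auto simp: subset.chain_def)
    ultimately have "ideal (\<Union>C) R"
      using chain_Union_is_ideal[of C] by simp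
    then show "\<Union>C \<in> ?A"
      using C by (auto simp: subset.chain_def)
  qed
  then obtain M where M: "ideal M R" "\<one> \<notin> M"
    and max: "\<And>X. ideal X R \<Longrightarrow> \<one> \<notin> X \<Longrightarrow> M \<subseteq> X \<Longrightarrow> X = M"
    by blast
  have "maximalideal M R"
  proof (rule maximalidealI)
    show "carrier R \<noteq> M" using M(2) by blast
    show "J = M \<or> J = carrier R" if "ideal J R" "M \<subseteq> J" for J
      using max[OF that(1) _ that(2)] ideal.one_imp_carrier[OF that(1)] by blast
  qed (rule M(1))
  then show ?thesis by (rule that)
qed

section \<open>Prime ideals, in particular those of the power set ring\<close>

lemma primeideal_one_notin:
  assumes "primeideal P A"
  shows "\<one>\<^bsub>A\<^esub> \<notin> P"
  using assms ideal.one_imp_carrier primeideal.I_notcarr primeideal.axioms(1) by metis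

lemma primeideal_zero_in:
  assumes "primeideal P A"
  shows "\<zero>\<^bsub>A\<^esub> \<in> P"
  by (rule additive_subgroup.zero_closed[OF ideal.axioms(1)[OF primeideal.axioms(1)[OF assms]]])

context
  fixes S :: "'i set" and M :: "'i set set"
  assumes M: "primeideal M (powerset_ring S)"
begin

lemma powerset_prime_Pow: "X \<in> M \<Longrightarrow> X \<subseteq> S"
  using additive_subgroup.a_subset[OF ideal.axioms(1)[OF primeideal.axioms(1)[OF M]]]
  by (auto simp: powerset_ring_def)

lemma powerset_prime_notin: "S \<notin> M"
  using primeideal_one_notin[OF M] by (simp add: powerset_ring_def)

lemma powerset_prime_empty: "{} \<in> M"
  using primeideal_zero_in[OF M] by (simp add: powerset_ring_def)

lemma powerset_prime_subset:
  assumes "X \<in> M" "Y \<subseteq> X"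
  shows "Y \<in> M"
proof -
  have "Y \<in> carrier (powerset_ring S)"
    using assms powerset_prime_Pow by (auto simp: powerset_ring_def)
  then have "Y \<otimes>\<^bsub>powerset_ring S\<^esub> X \<in> M"
    using ideal.I_l_closed[OF primeideal.axioms(1)[OF M] assms(1)] by blast
  then show ?thesis
    using assms(2) by (simp add: powerset_ring_def Int_absorb2)
qed

text \<open>Addition is symmetric difference, so the union is the sum of the disjoint sets
  \<open>X\<close> and \<open>Y - X\<close>; the latter lies in \<open>M\<close> by downward
  closure.\<close>

lemma powerset_prime_Un:
  assumes "X \<in> M" "Y \<in> M"
  shows "X \<union> Y \<in> M"
proof -
  have "X \<oplus>\<^bsub>powerset_ring S\<^esub> (Y - X) \<in> M"
    by (rule additive_subgroup.a_closed[OF ideal.axioms(1)[OF primeideal.axioms(1)[OF M]]])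
      (use assms(1) powerset_prime_subset[OF assms(2)] in auto)
  moreover have "X \<oplus>\<^bsub>powerset_ring S\<^esub> (Y - X) = X \<union> Y"
    by (auto simp: powerset_ring_def)
  ultimately show ?thesis by simp
qed

lemma powerset_prime_Int:
  assumes "X \<subseteq> S" "Y \<subseteq> S" "X \<inter> Y \<in> M"
  shows "X \<in> M \<or> Y \<in> M"
  using primeideal.I_prime[OF M, of X Y] assms by (simp add: powerset_ring_def)

end

section \<open>Supports and the prime of the product attached to a prime of the power set
  ring\<close>

definition support_mod :: "'i set \<Rightarrow> ('i \<Rightarrow> 'a set) \<Rightarrow> ('i \<Rightarrow> 'a) \<Rightarrow> 'i set"
  where "support_mod S \<mm> x = {i \<in> S. x i \<notin> \<mm> i}"

text \<open>For prime \<open>M\<close> the complements of its members form an ultrafilter on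
  \<open>S\<close>; this is then the kernel of the map from the product to the ultraproduct of the
  quotients of \<open>R i\<close> by \<open>\<mm> i\<close>.\<close>

definition ultra_ideal ::
    "'i set \<Rightarrow> ('i \<Rightarrow> ('a, 'm) ring_scheme) \<Rightarrow> ('i \<Rightarrow> 'a set) \<Rightarrow> 'i set set \<Rightarrow> ('i \<Rightarrow> 'a) set"
  where "ultra_ideal S R \<mm> M = {x \<in> carrier (product_ring S R). support_mod S \<mm> x \<in> M}"

text \<open>The idempotents that serve as test elements: membership of a set in \<open>M\<close> is
  read off from them.\<close>

definition indicator_elt :: "'i set \<Rightarrow> ('i \<Rightarrow> ('a, 'm) ring_scheme) \<Rightarrow> 'i set \<Rightarrow> 'i \<Rightarrow> 'a"
  where "indicator_elt S R X = (\<lambda>i\<in>S. if i \<in> X then \<one>\<^bsub>R i\<^esub> else \<zero>\<^bsub>R i\<^esub>)"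

lemma support_mod_subset: "support_mod S \<mm> x \<subseteq> S"
  by (auto simp: support_mod_def)

context
  fixes S :: "'i set" and R :: "'i \<Rightarrow> ('a, 'm) ring_scheme" and \<mm> :: "'i \<Rightarrow> 'a set"
  assumes \<mm>: "\<And>i. i \<in> S \<Longrightarrow> primeideal (\<mm> i) (R i)"
begin

lemma cring_factor: "i \<in> S \<Longrightarrow> cring (R i)"
  using \<mm> primeideal.axioms(2) by blast

lemma indicator_elt_carrier: "indicator_elt S R X \<in> carrier (product_ring S R)"
  using cring.cring_simprules[OF cring_factor]
  by (auto simp: indicator_elt_def product_ring_def)

lemma support_mod_indicator:
  assumes "X \<subseteq> S"
  shows "support_mod S \<mm> (indicator_elt S R X) = X"
  using assms primeideal_one_notin[OF \<mm>] primeideal_zero_in[OF \<mm>]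
  by (auto simp: support_mod_def indicator_elt_def split: if_splits)

lemma indicator_elt_ultra_iff:
  assumes "X \<subseteq> S"
  shows "indicator_elt S R X \<in> ultra_ideal S R \<mm> M \<longleftrightarrow> X \<in> M"
  by (simp add: ultra_ideal_def indicator_elt_carrier support_mod_indicator[OF assms])

text \<open>At each index, one inclusion is absorption by \<open>\<mm> i\<close> and the other is
  its primality.\<close>

lemma support_mod_mult:
  assumes "x \<in> carrier (product_ring S R)" "y \<in> carrier (product_ring S R)"
  shows "support_mod S \<mm> (x \<otimes>\<^bsub>product_ring S R\<^esub> y) = support_mod S \<mm> x \<inter> support_mod S \<mm> y"
proof -
  have "x i \<otimes>\<^bsub>R i\<^esub> y i \<in> \<mm> i \<longleftrightarrow> x i \<in> \<mm> i \<or> y i \<in> \<mm> i" if "i \<in> S" for i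
  proof -
    interpret primeideal "\<mm> i" "R i" by (rule \<mm>[OF that])
    have "x i \<in> carrier (R i)" "y i \<in> carrier (R i)"
      using assms that by (auto simp: product_ring_def)
    then show ?thesis
      using I_prime I_l_closed I_r_closed by blast
  qed
  then show ?thesis
    by (auto simp: support_mod_def product_ring_def)
qed

text \<open>Two values outside \<open>\<mm> i\<close> may have their sum inside it, so only an
  inclusion holds; downward closure of \<open>M\<close> makes it sufficient.\<close>

lemma support_mod_add:
  "support_mod S \<mm> (x \<oplus>\<^bsub>product_ring S R\<^esub> y) \<subseteq> support_mod S \<mm> x \<union> support_mod S \<mm> y"
proof -
  have "x i \<oplus>\<^bsub>R i\<^esub> y i \<in> \<mm> i" if "i \<in> S" "x i \<in> \<mm> i" "y i \<in> \<mm> i" for i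
    by (meson \<mm> additive_subgroup.a_closed ideal.axioms(1) primeideal.axioms(1) that)
  then show ?thesis
    by (auto simp: support_mod_def product_ring_def)
qed

lemma primeideal_ultra_ideal:
  assumes M: "primeideal M (powerset_ring S)"
  shows "primeideal (ultra_ideal S R \<mm> M) (product_ring S R)"
proof -
  let ?P = "product_ring S R" and ?I = "ultra_ideal S R \<mm> M"
  interpret P: cring ?P
    by (rule product_ring_cring[OF cring_factor])
  \<comment> \<open>Proved first because closure under negation also follows from it, by multiplying
    with minus one.\<close>
  have mult: "x \<otimes>\<^bsub>?P\<^esub> y \<in> ?I" if "x \<in> ?I" "y \<in> carrier ?P" for x y
    using that support_mod_mult[of x y] powerset_prime_subset[OF M, of "support_mod S \<mm> x"]
    by (auto simp: ultra_ideal_def)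
  show ?thesis
  proof (rule primeidealI)
    show "ideal ?I ?P"
    proof (rule idealI)
      show "subgroup ?I (add_monoid ?P)"
      proof (rule P.add.subgroupI)
        show "?I \<subseteq> carrier ?P"
          by (auto simp: ultra_ideal_def)
        have "indicator_elt S R {} \<in> ?I"
          using indicator_elt_ultra_iff powerset_prime_empty[OF M] by blast
        then show "?I \<noteq> {}" by blast
        show "\<ominus>\<^bsub>?P\<^esub> x \<in> ?I" if "x \<in> ?I" for x
        proof -
          have "x \<in> carrier ?P" using that by (simp add: ultra_ideal_def)
          then have "\<ominus>\<^bsub>?P\<^esub> x = x \<otimes>\<^bsub>?P\<^esub> (\<ominus>\<^bsub>?P\<^esub> \<one>\<^bsub>?P\<^esub>)"
            by (simp add: P.r_minus)
          then show ?thesis using mult[OF that] by simp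
        qed
        show "x \<oplus>\<^bsub>?P\<^esub> y \<in> ?I" if "x \<in> ?I" "y \<in> ?I" for x y
          using that powerset_prime_subset[OF M powerset_prime_Un[OF M] support_mod_add[of x y]]
          by (simp add: ultra_ideal_def)
      qed
      show "y \<otimes>\<^bsub>?P\<^esub> x \<in> ?I" if "x \<in> ?I" "y \<in> carrier ?P" for x y
        using mult[OF that] that P.m_comm[of x y] by (simp add: ultra_ideal_def)
    qed (use mult P.ring_axioms in auto)
    have "indicator_elt S R S \<notin> ?I"
      using indicator_elt_ultra_iff powerset_prime_notin[OF M] by blast
    then show "carrier ?P \<noteq> ?I"
      using indicator_elt_carrier by blast
    show "x \<in> ?I \<or> y \<in> ?I" if "x \<in> carrier ?P" "y \<in> carrier ?P" "x \<otimes>\<^bsub>?P\<^esub> y \<in> ?I" for x y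
      using that support_mod_mult[of x y]
        powerset_prime_Int[OF M support_mod_subset[of S \<mm> x] support_mod_subset[of S \<mm> y]]
      by (auto simp: ultra_ideal_def)
  qed (rule P.is_cring)
qed

text \<open>The criterion involves \<open>M\<close> alone, which lets wildness be compared between
  different families of factors. The excluded \<open>M\<close> are those whose ultrafilter of
  complements is principal.\<close>

lemma wild_prime_ultra_ideal:
  assumes M: "primeideal M (powerset_ring S)"
  shows "wild_prime S R (ultra_ideal S R \<mm> M) \<longleftrightarrow> \<not> (\<exists>k\<in>S. M = Pow (S - {k}))"
proof -
  let ?P = "product_ring S R" and ?I = "ultra_ideal S R \<mm> M"
  have "\<exists>k\<in>S. M = Pow (S - {k})"
    if "k \<in> S" "primeideal \<pp> (R k)" and I: "?I = (\<lambda>x. x k) -` \<pp> \<inter> carrier ?P" for k \<pp>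
  proof
    \<comment> \<open>Coordinate \<open>k\<close> of the idempotent of \<open>X\<close> is one or
      zero, so whether it lies in \<open>\<pp>\<close> does not depend on which prime
      \<open>\<pp>\<close> is.\<close>
    have "X \<in> M \<longleftrightarrow> k \<notin> X" if X: "X \<subseteq> S" for X
    proof -
      have "X \<in> M \<longleftrightarrow> indicator_elt S R X k \<in> \<pp>"
        using indicator_elt_ultra_iff[OF X, of M] indicator_elt_carrier[of X] I by auto
      then show ?thesis
        using \<open>k \<in> S\<close> primeideal_one_notin[OF \<open>primeideal \<pp> (R k)\<close>]
          primeideal_zero_in[OF \<open>primeideal \<pp> (R k)\<close>]
        by (simp add: indicator_elt_def)
    qed
    moreover have "M \<subseteq> Pow S"
      using powerset_prime_Pow[OF M] by (simp add: subset_iff)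
    ultimately show "M = Pow (S - {k})"
      unfolding set_eq_iff Pow_iff subset_Diff_insert Diff_empty by (metis PowD subsetD)
  qed fact
  moreover have "\<exists>k\<in>S. \<exists>\<pp>. primeideal \<pp> (R k) \<and> ?I = (\<lambda>x. x k) -` \<pp> \<inter> carrier ?P"
    if k: "k \<in> S" "M = Pow (S - {k})" for k
  proof -
    \<comment> \<open>The support of \<open>x\<close> avoids \<open>k\<close> exactly when
      \<open>x k \<in> \<mm> k\<close>, so \<open>\<mm> k\<close> itself witnesses tameness.\<close>
    have "?I = (\<lambda>x. x k) -` \<mm> k \<inter> carrier ?P"
      using k by (auto simp: ultra_ideal_def support_mod_def)
    then show ?thesis
      using k(1) \<mm>[OF k(1)] by metis
  qed
  ultimately have "tame_prime S R ?I \<longleftrightarrow> (\<exists>k\<in>S. M = Pow (S - {k}))"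
    using primeideal_ultra_ideal[OF M] unfolding tame_prime_def by metis
  then show ?thesis
    using primeideal_ultra_ideal[OF M] by (simp add: wild_prime_def)
qed

lemma inj_on_ultra_ideal: "inj_on (ultra_ideal S R \<mm>) (Spec (powerset_ring S))"
proof (rule inj_onI)
  fix M N assume "M \<in> Spec (powerset_ring S)" "N \<in> Spec (powerset_ring S)"
    and eq: "ultra_ideal S R \<mm> M = ultra_ideal S R \<mm> N"
  then have "X \<subseteq> S" if "X \<in> M \<union> N" for X
    using that powerset_prime_Pow by (fastforce simp: Spec_def)
  moreover have "X \<in> M \<longleftrightarrow> X \<in> N" if "X \<subseteq> S" for X
    using indicator_elt_ultra_iff[OF that] eq by metis
  ultimately show "M = N" by blast
qed

lemma continuous_map_ultra_ideal:
  "continuous_map (zariski (powerset_ring S)) (zariski (product_ring S R)) (ultra_ideal S R \<mm>)"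
  unfolding continuous_map
proof (intro conjI allI impI)
  have *: "ultra_ideal S R \<mm> M \<in> Spec (product_ring S R)" if "M \<in> Spec (powerset_ring S)" for M
    using that primeideal_ultra_ideal by (simp add: Spec_def)
  then show "ultra_ideal S R \<mm> ` topspace (zariski (powerset_ring S))
      \<subseteq> topspace (zariski (product_ring S R))"
    by auto
  fix U assume "openin (zariski (product_ring S R)) U"
  then obtain E where E: "E \<subseteq> carrier (product_ring S R)"
    and U: "U = Spec (product_ring S R) - {P \<in> Spec (product_ring S R). E \<subseteq> P}"
    unfolding openin_zariski by blast
  \<comment> \<open>Thus the closed set defined by \<open>E\<close> pulls back to the closed set
    defined by the supports of the elements of \<open>E\<close>.\<close>
  have "E \<subseteq> ultra_ideal S R \<mm> M \<longleftrightarrow> support_mod S \<mm> ` E \<subseteq> M" for M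
    using E by (auto simp: ultra_ideal_def)
  then have "{M \<in> topspace (zariski (powerset_ring S)). ultra_ideal S R \<mm> M \<in> U}
      = Spec (powerset_ring S) - {M \<in> Spec (powerset_ring S). support_mod S \<mm> ` E \<subseteq> M}"
    using * U by auto
  moreover have "support_mod S \<mm> ` E \<subseteq> carrier (powerset_ring S)"
    using support_mod_subset by (fastforce simp: powerset_ring_def)
  ultimately show "openin (zariski (powerset_ring S))
      {M \<in> topspace (zariski (powerset_ring S)). ultra_ideal S R \<mm> M \<in> U}"
    unfolding openin_zariski by blast
qed

end

section \<open>The two-element factors and the identification \<open>char_fun\<close>\<close>

lemma primeideal_zero_residue_ring_2: "primeideal {0} (residue_ring 2)"
proof -
  interpret residues_prime 2 "residue_ring 2"
    by unfold_locales auto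
  show ?thesis
    using zeroprimeideal by (simp add: residue_ring_def)
qed

text \<open>Over the two-element ring every element of the product is the characteristic function of
  its support modulo \<open>{0}\<close>. The general wildness criterion therefore applies to the
  identified prime as well.\<close>

lemma char_fun_image_eq_ultra_ideal:
  assumes "M \<subseteq> Pow S"
  shows "char_fun S ` M = ultra_ideal S (\<lambda>_. residue_ring 2) (\<lambda>_. {0}) M"
proof -
  have support: "support_mod S (\<lambda>_. {0}) (char_fun S X) = X" if "X \<subseteq> S" for X
    using that by (auto simp: support_mod_def char_fun_def)
  have carrier: "char_fun S ` Pow S = carrier (product_ring S (\<lambda>_. residue_ring 2))"
    using char_fun_ring_iso[of S] by (simp add: ring_iso_def bij_betw_def powerset_ring_def)
  show ?thesis
  proof
    have "support_mod S (\<lambda>_. {0}) (char_fun S X) \<in> M" if "X \<in> M" for X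
      using that support[of X] assms by auto
    then show "char_fun S ` M \<subseteq> ultra_ideal S (\<lambda>_. residue_ring 2) (\<lambda>_. {0}) M"
      unfolding ultra_ideal_def carrier[symmetric] using assms by blast
    show "ultra_ideal S (\<lambda>_. residue_ring 2) (\<lambda>_. {0}) M \<subseteq> char_fun S ` M"
      unfolding ultra_ideal_def carrier[symmetric] using support by auto
  qed
qed

theorem theorem2p12:
  fixes S :: "'i set" and R :: "'i \<Rightarrow> ('a, 'm) ring_scheme"
  assumes "\<And>i. i \<in> S \<Longrightarrow> cring (R i)"
    and "\<And>i. i \<in> S \<Longrightarrow> carrier (R i) \<noteq> {\<zero>\<^bsub>R i\<^esub>}"
  shows "\<exists>f. continuous_map (zariski (powerset_ring S)) (zariski (product_ring S R)) f \<and>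
             inj_on f (Spec (powerset_ring S)) \<and>
             (\<forall>M\<in>Spec (powerset_ring S).
                wild_prime_powerset S M \<longleftrightarrow> wild_prime S R (f M))"
proof -
  have "\<exists>I. primeideal I (R i)" if "i \<in> S" for i
    using assms[OF that] ring.exists_maximalideal cring.maximalideal_prime cring.axioms(1) by metis
  then obtain \<mm> where \<mm>: "\<And>i. i \<in> S \<Longrightarrow> primeideal (\<mm> i) (R i)"
    by metis
  \<comment> \<open>Both sides reduce to \<open>M\<close> being none of the sets
    \<open>Pow (S - {k})\<close> with \<open>k \<in> S\<close>: the criterion is used once with zero
    ideals in the two-element rings, once with the chosen \<open>\<mm>\<close>.\<close>
  have "wild_prime_powerset S M \<longleftrightarrow> wild_prime S R (ultra_ideal S R \<mm> M)"
    if "M \<in> Spec (powerset_ring S)" for M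
  proof -
    have M: "primeideal M (powerset_ring S)"
      using that by (simp add: Spec_def)
    have "M \<subseteq> Pow S"
      using powerset_prime_Pow[OF M] by (simp add: subset_iff)
    then have "char_fun S ` M = ultra_ideal S (\<lambda>_. residue_ring 2) (\<lambda>_. {0}) M"
      by (rule char_fun_image_eq_ultra_ideal)
    then show ?thesis
      using M wild_prime_ultra_ideal[OF primeideal_zero_residue_ring_2 M]
        wild_prime_ultra_ideal[of S \<mm> R, OF \<mm> M]
      by (simp add: wild_prime_powerset_def)
  qed
  then show ?thesis
    using continuous_map_ultra_ideal[of S \<mm> R, OF \<mm>] inj_on_ultra_ideal[of S \<mm> R, OF \<mm>] by blast
qed

end
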